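(* The radii of the classes $\mathcal{G}_1,\mathcal{G}_2,\mathcal{G}_3$ with respect to the class $\mathcal{S}_L^*$ (starlike functions associated with the lemniscate of Bernoulli) are exactly: (i) $R_{\mathcal{S}_{L}^{*}}(\mathcal{G}_1)= \dfrac{3-2\sqrt{2}}{(\sqrt{2}-1)\left(3+\sqrt{12-2\sqrt{2}}\right)}\approx 0.0687$; (ii) $R_{\mathcal{S}_{L}^{*}}(\mathcal{G}_2)= \dfrac{2(\sqrt{2}-1)}{5+\sqrt{33-4\sqrt{2}}}\approx 0.0809$; (iii) $R_{\mathcal{S}_{L}^{*}}(\mathcal{G}_3)= \dfrac{3-2\sqrt{2}}{(\sqrt{2}-1)\left(2+\sqrt{7-2\sqrt{2}}\right)}\approx 0.1025$.
   Context: $\mathbb{D}$ is the open unit disc in $\mathbb{C}$. $\mathcal{A}$ is the class of analytic functions $f$ on $\mathbb{D}$ with $f(0)=0$, $f'(0)=1$. $\mathcal{P}$ is the class of analytic functions $p$ on $\mathbb{D}$ with $p(0)=1$ and $\operatorname{Re}p(z)>0$ for all $z\in\mathbb{D}$; $\mathcal{P}(1/2)=\{p\in\mathcal{P}:\operatorname{Re}p(z)>1/2 \text{ for all } z\in\mathbb{D}\}$. Quotients below are understood with removable singularities filled in (in particular at $0$). Define $\mathcal{G}_1=\{f\in\mathcal{A}: f/g\in\mathcal{P}\text{ and } g/(zp)\in\mathcal{P}\text{ for some } g\in\mathcal{A},\ p\in\mathcal{P}\}$, $\mathcal{G}_2=\{f\in\mathcal{A}: f/g\in\mathcal{P}\text{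 and } g/(zp)\in\mathcal{P}(1/2)\text{ for some } g\in\mathcal{A},\ p\in\mathcal{P}\}$, $\mathcal{G}_3=\{f\in\mathcal{A}: f/(zp)\in\mathcal{P}\text{ for some } p\in\mathcal{P}\}$. For subclasses $\mathcal{F},\mathcal{G}$ of $\mathcal{A}$, the $\mathcal{G}$-radius $R_{\mathcal{G}}(\mathcal{F})$ of $\mathcal{F}$ is the largest number $R\in(0,1)$ such that, for every $f\in\mathcal{F}$ and every $0<r<R$, the function $z\mapsto r^{-1}f(rz)$ belongs to $\mathcal{G}$. For analytic $f,g$ on $\mathbb{D}$, $f\prec g$ ($f$ is subordinate to $g$) means $f=g\circ w$ for some analytic $w:\mathbb{D}\to\mathbb{D}$ with $w(0)=0$. For an analytic univalent $\varphi$ on $\mathbb{D}$ with $\varphi(0)=1$, $\mathcal{S}^*(\varphi)=\{f\in\mathcal{A}: zf'(z)/f(z)\prec\varphi(z)\}$. $\mathcal{S}_L^*=\mathcal{S}^*(\sqrt{1+z})$ (principal branch); its members are those $f$ for which $zf'(z)/f(z)$ lies in the region bounded by the right half of the lemniscate $|w^2-1|=1$. *)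

theory Defs
  imports "HOL-Complex_Analysis.Complex_Analysis"
begin

text \<open>Analytic functions on the open unit disc are represented by total functions
  \<open>complex \<Rightarrow> complex\<close> that are holomorphic on the disc. Every predicate below
  depends only on the values on the disc; values outside are irrelevant.\<close>

abbreviation unit_disc :: "complex set" where
  "unit_disc \<equiv> ball 0 1"

definition class_A :: "(complex \<Rightarrow> complex) set" where
  "class_A = {f. f holomorphic_on unit_disc \<and> f 0 = 0 \<and> deriv f 0 = 1}"

definition class_P :: "(complex \<Rightarrow> complex) set" where
  "class_P = {p. p holomorphic_on unit_disc \<and> p 0 = 1 \<and> (\<forall>z\<in>unit_disc. Re (p z) > 0)}"

definition class_P_half :: "(complex \<Rightarrow> complex) set" where
  "class_P_half = {p \<in> class_P. \<forall>z\<in>unit_disc. Re (p z) > 1/2}"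

text \<open>Quotient with removable singularities filled in. The library operator \<open>remove_sings\<close>
  returns the limit at each point where it exists. It returns 0 at a pole, but there the
  resulting function is not continuous, so no quotient with a genuine pole in the disc is
  holomorphic on it.\<close>

definition quot :: "(complex \<Rightarrow> complex) \<Rightarrow> (complex \<Rightarrow> complex) \<Rightarrow> complex \<Rightarrow> complex" where
  "quot f g = remove_sings (\<lambda>z. f z / g z)"

definition class_G1 :: "(complex \<Rightarrow> complex) set" where
  "class_G1 = {f \<in> class_A. \<exists>g\<in>class_A. \<exists>p\<in>class_P.
     quot f g \<in> class_P \<and> quot g (\<lambda>z. z * p z) \<in> class_P}"

definition class_G2 :: "(complex \<Rightarrow> complex) set" where
  "class_G2 = {f \<in> class_A. \<exists>g\<in>class_A. \<exists>p\<in>class_P.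
     quot f g \<in> class_P \<and> quot g (\<lambda>z. z * p z) \<in> class_P_half}"

definition class_G3 :: "(complex \<Rightarrow> complex) set" where
  "class_G3 = {f \<in> class_A. \<exists>p\<in>class_P. quot f (\<lambda>z. z * p z) \<in> class_P}"

definition subordinate :: "(complex \<Rightarrow> complex) \<Rightarrow> (complex \<Rightarrow> complex) \<Rightarrow> bool" where
  "subordinate f g \<longleftrightarrow> f holomorphic_on unit_disc \<and> g holomorphic_on unit_disc \<and>
     (\<exists>w. w holomorphic_on unit_disc \<and> w ` unit_disc \<subseteq> unit_disc \<and> w 0 = 0 \<and>
          (\<forall>z\<in>unit_disc. f z = g (w z)))"

definition starlike_class :: "(complex \<Rightarrow> complex) \<Rightarrow> (complex \<Rightarrow> complex) set" where
  "starlike_class \<phi> = {f \<in> class_A. subordinate (quot (\<lambda>z. z * deriv f z) f) \<phi>}"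

definition lemniscate_starlike :: "(complex \<Rightarrow> complex) set" where
  "lemniscate_starlike = starlike_class (\<lambda>z. csqrt (1 + z))"

text \<open>\<open>is_radius G F R\<close>: the \<open>G\<close>-radius of \<open>F\<close> exists and equals \<open>R\<close>. A predicate is used
  instead of a function since the largest admissible number need not exist in \<open>(0,1)\<close>.\<close>

definition admissible_radii ::
    "(complex \<Rightarrow> complex) set \<Rightarrow> (complex \<Rightarrow> complex) set \<Rightarrow> real set" where
  "admissible_radii G F = {R. 0 < R \<and> R < 1 \<and>
     (\<forall>f\<in>F. \<forall>r::real. 0 < r \<and> r < R \<longrightarrow> (\<lambda>z. f (of_real r * z) / of_real r) \<in> G)}"

definition is_radius ::
    "(complex \<Rightarrow> complex) set \<Rightarrow> (complex \<Rightarrow> complex) set \<Rightarrow> real \<Rightarrow> bool" where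
  "is_radius G F R \<longleftrightarrow>
     R \<in> admissible_radii G F \<and> (\<forall>R'\<in>admissible_radii G F. R' \<le> R)"

end

theory Submission
  imports Defs
begin

text \<open>
  Clearing the quotients in the definitions shows that each class consists of the functions
  \<open>f z = z * h z\<close> where \<open>h\<close> is a product of functions with positive real part: three from
  \<open>\<P>\<close> for \<open>\<G>\<^sub>1\<close>, two from \<open>\<P>\<close> and one from \<open>\<P>(1/2)\<close> for \<open>\<G>\<^sub>2\<close>, two from \<open>\<P>\<close> for \<open>\<G>\<^sub>3\<close>
  (\<open>class_G1_iff\<close>, \<open>class_G2_iff\<close>, \<open>class_G3_iff\<close>). Hence \<open>z f'/f - 1\<close> is the sum of the
  quantities \<open>z p'/p\<close> over the factors. By the Schwarz--Pick estimate each of these is at most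
  \<open>2r/(1 - r\<^sup>2)\<close> on \<open>|z| = r\<close> for a factor in \<open>\<P>\<close>, and at most \<open>r/(1 - r)\<close> for a factor in
  \<open>\<P>(1/2)\<close>, which is written \<open>r(1 + r)/(1 - r\<^sup>2)\<close> to give all bounds one denominator. So
  \<open>|z f'/f - 1| \<le> (a r + b r\<^sup>2)/(1 - r\<^sup>2)\<close>, with \<open>(a, b) = (6, 0), (5, 1), (4, 0)\<close>.

  The disc of radius \<open>sqrt 2 - 1\<close> about 1 lies in the lemniscate region \<open>|w\<^sup>2 - 1| < 1\<close>, \<open>Re w > 0\<close>,
  because there \<open>|w - 1| |w + 1| < (sqrt 2 - 1)(sqrt 2 + 1) = 1\<close>. Thus it is enough that the bound
  stays below \<open>sqrt 2 - 1\<close>, and this holds exactly up to the positive root \<open>R\<close> of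
  \<open>(b + sqrt 2 - 1) R\<^sup>2 + a R = sqrt 2 - 1\<close>, which is the asserted radius.

  The value cannot be improved. For the factors \<open>(1 + z)/(1 - z)\<close> in \<open>\<P>\<close> and \<open>1/(1 - z)\<close> in
  \<open>\<P>(1/2)\<close> all estimates are equalities at positive real points. Therefore \<open>z f'/f\<close> is a real
  number above \<open>sqrt 2\<close> at every point of \<open>(R, 1)\<close>, and \<open>sqrt 2\<close> is the rightmost boundary point
  of the lemniscate region, which is where the disc touches the boundary. The lemma
  \<open>is_radius_lemniscateI\<close> turns such a sharp bound into the radius.
\<close>

section \<open>The logarithmic derivative\<close>

definition zlogd :: "(complex \<Rightarrow> complex) \<Rightarrow> complex \<Rightarrow> complex" where
  "zlogd h z = z * deriv h z / h z"

lemma zlogd_mult: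
  assumes "f holomorphic_on unit_disc" "g holomorphic_on unit_disc" "z \<in> unit_disc"
    "f z \<noteq> 0" "g z \<noteq> 0"
  shows "zlogd (\<lambda>w. f w * g w) z = zlogd f z + zlogd g z"
proof -
  have "((\<lambda>w. f w * g w) has_field_derivative deriv f z * g z + deriv g z * f z) (at z)"
    using assms by (intro DERIV_mult holomorphic_derivI[of _ unit_disc]) auto
  then have "deriv (\<lambda>w. f w * g w) z = deriv f z * g z + deriv g z * f z"
    by (rule DERIV_imp_deriv)
  then show ?thesis using assms by (simp add: zlogd_def field_simps)
qed

lemma zlogd_scale:
  assumes "h holomorphic_on unit_disc" "c * z \<in> unit_disc"
  shows "zlogd (\<lambda>w. h (c * w)) z = zlogd h (c * z)"
proof -
  have "(h has_field_derivative deriv h (c * z)) (at (c * z))"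
    using assms by (intro holomorphic_derivI[of _ unit_disc]) auto
  moreover have "((\<lambda>w. c * w) has_field_derivative c) (at z)"
    by (rule derivative_eq_intros refl | simp)+
  ultimately have "((\<lambda>w. h (c * w)) has_field_derivative deriv h (c * z) * c) (at z)"
    by (rule DERIV_chain2)
  then show ?thesis by (simp add: zlogd_def DERIV_imp_deriv)
qed

lemma deriv_id_mult:
  assumes h: "h holomorphic_on unit_disc" and F: "\<And>z. z \<in> unit_disc \<Longrightarrow> F z = z * h z"
    and z: "z \<in> unit_disc"
  shows "deriv F z = h z + z * deriv h z"
proof -
  have "((\<lambda>z. z * h z) has_field_derivative h z + z * deriv h z) (at z)"
    by (rule derivative_eq_intros holomorphic_derivI[OF h] refl | use z in simp)+
  then have "(F has_field_derivative h z + z * deriv h z) (at z)"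
    by (rule has_field_derivative_transform_within_open[of _ _ _ unit_disc]) (use F z in auto)
  then show ?thesis by (rule DERIV_imp_deriv)
qed

lemma mult_deriv_id_mult:
  assumes "h holomorphic_on unit_disc" "\<And>z. z \<in> unit_disc \<Longrightarrow> F z = z * h z"
    "z \<in> unit_disc" "h z \<noteq> 0"
  shows "z * deriv F z = F z * (1 + zlogd h z)"
  using assms deriv_id_mult[OF assms(1-3)] by (simp add: zlogd_def field_simps)

section \<open>Derivative bounds for functions with positive real part\<close>

text \<open>This is the Schwarz--Pick estimate for the right half-plane. A disc automorphism \<open>M\<close> moves \<open>a\<close>
  to the origin and the Cayley transform \<open>w \<mapsto> (w - p a) / (w + cnj (p a))\<close> maps the half-plane to
  the disc, taking \<open>p a\<close> to 0. The Schwarz lemma bounds the derivative at 0 of the resulting self-map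
  \<open>\<psi>\<close> of the disc, and that derivative is \<open>p'(a) (1 - |a|\<^sup>2) / (2 Re (p a))\<close>.\<close>

lemma deriv_bound_Re_pos:
  assumes hol: "p holomorphic_on unit_disc" and pos: "\<And>z. z \<in> unit_disc \<Longrightarrow> Re (p z) > 0"
    and a: "norm a < 1"
  shows "norm (deriv p a) * (1 - (norm a)\<^sup>2) \<le> 2 * Re (p a)"
proof -
  define M where "M = Moebius_function 0 (-a)"
  define \<psi> where "\<psi> = (\<lambda>w. (p (M w) - p a) / (p (M w) + cnj (p a)))"
  have M_hol: "M holomorphic_on unit_disc"
    unfolding M_def by (rule Moebius_function_holomorphic) (use a in auto)
  have M_disc: "M w \<in> unit_disc" if "norm w < 1" for w
    using Moebius_function_norm_lt_1[of "-a" w 0] that a by (simp add: M_def)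
  have M0: "M 0 = a" by (simp add: M_def Moebius_function_def)
  have a2: "(norm a)\<^sup>2 < 1" using a by (simp add: abs_square_less_1)
  have M': "(M has_field_derivative of_real (1 - (norm a)\<^sup>2)) (at 0)"
    unfolding M_def Moebius_function_def
    by (rule derivative_eq_intros refl | simp)+
       (simp add: complex_norm_square [symmetric] mult.commute)
  have Re_a: "Re (p a) > 0" using pos a by simp
  have den: "p (M w) + cnj (p a) \<noteq> 0" if "norm w < 1" for w
    using pos[OF M_disc[OF that]] Re_a by (auto simp: complex_eq_iff)
  have pM: "(\<lambda>w. p (M w)) holomorphic_on unit_disc"
    using holomorphic_on_compose_gen[OF M_hol hol] M_disc by (auto simp: o_def image_subset_iff)
  have \<psi>_hol: "\<psi> holomorphic_on unit_disc"
    unfolding \<psi>_def by (intro holomorphic_intros pM) (use den in auto)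
  have \<psi>0: "\<psi> 0 = 0" by (simp add: \<psi>_def M0)
  have \<psi>_lt: "norm (\<psi> w) < 1" if "norm w < 1" for w
  proof -
    have "Re (p (M w)) * Re (p a) > 0" using pos[OF M_disc[OF that]] Re_a by simp
    then have "(norm (p (M w) - p a))\<^sup>2 < (norm (p (M w) + cnj (p a)))\<^sup>2"
      by (simp only: cmod_power2) (simp add: power2_eq_square algebra_simps)
    then have "norm (p (M w) - p a) < norm (p (M w) + cnj (p a))"
      using power_less_imp_less_base norm_ge_zero by blast
    then show ?thesis using den[OF that] by (simp add: \<psi>_def norm_divide divide_simps)
  qed
  have p': "(p has_field_derivative deriv p a) (at (M 0))"
    unfolding M0 using hol a by (intro holomorphic_derivI[of _ unit_disc]) auto
  have pM': "((\<lambda>w. p (M w)) has_field_derivative deriv p a * of_real (1 - (norm a)\<^sup>2)) (at 0)"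
    using DERIV_chain2[OF p' M'] .
  have "(\<psi> has_field_derivative deriv p a * of_real (1 - (norm a)\<^sup>2) / (2 * of_real (Re (p a)))) (at 0)"
    unfolding \<psi>_def
    apply (rule derivative_eq_intros pM' refl)+
    using den[of 0] Re_a by (simp_all add: M0 complex_add_cnj field_simps)
  then have "deriv \<psi> 0 = deriv p a * of_real (1 - (norm a)\<^sup>2) / (2 * of_real (Re (p a)))"
    by (rule DERIV_imp_deriv)
  moreover have "norm (deriv \<psi> 0) \<le> 1"
    using Schwarz_Lemma(2)[OF \<psi>_hol \<psi>0 \<psi>_lt, of 0] by simp
  moreover have "norm (deriv p a * complex_of_real (1 - (norm a)\<^sup>2) / (2 * of_real (Re (p a))))
      = norm (deriv p a) * (1 - (norm a)\<^sup>2) / (2 * Re (p a))"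
    using a2 Re_a by (simp only: norm_mult norm_divide norm_of_real) simp
  ultimately have "norm (deriv p a) * (1 - (norm a)\<^sup>2) / (2 * Re (p a)) \<le> 1"
    by (simp only:)
  then show ?thesis
    using Re_a by (simp add: divide_simps)
qed

lemma zlogd_bound_class_P:
  assumes "p \<in> class_P" "norm z < 1"
  shows "norm (zlogd p z) \<le> 2 * norm z / (1 - (norm z)\<^sup>2)"
proof -
  have p: "p holomorphic_on unit_disc" "\<And>z. z \<in> unit_disc \<Longrightarrow> Re (p z) > 0"
    using assms(1) by (auto simp: class_P_def)
  have z2: "(norm z)\<^sup>2 < 1" using assms by (simp add: abs_square_less_1)
  have "norm (deriv p z) * (1 - (norm z)\<^sup>2) \<le> 2 * norm (p z)"
    using deriv_bound_Re_pos[OF p assms(2)] complex_Re_le_cmod[of "p z"] by linarith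
  moreover have "norm (p z) > 0" using p(2)[of z] assms(2) by auto
  ultimately have "norm (deriv p z) / norm (p z) \<le> 2 / (1 - (norm z)\<^sup>2)"
    using z2 by (simp add: divide_simps)
  from mult_left_mono[OF this norm_ge_zero[of z]] show ?thesis
    by (simp add: zlogd_def norm_mult norm_divide mult_ac)
qed

text \<open>The function \<open>2 q - 1\<close> has positive real part, so the half-plane estimate gives
  \<open>|q'| (1 - |z|\<^sup>2) \<le> 2 Re q - 1 \<le> |q| (2 - 1/|q|)\<close>. It remains to bound \<open>|q|\<close> above by \<open>1/(1 - |z|)\<close>.
  The condition \<open>Re q > 1/2\<close> says that \<open>|1/q - 1| < 1\<close>, and \<open>1/q - 1\<close> vanishes at 0, so it is at
  most \<open>|z|\<close> in modulus by the Schwarz lemma.\<close>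

lemma zlogd_bound_class_P_half:
  assumes "q \<in> class_P_half" "norm z < 1"
  shows "norm (zlogd q z) \<le> norm z * (1 + norm z) / (1 - (norm z)\<^sup>2)"
proof -
  have q: "q holomorphic_on unit_disc" "q 0 = 1" "\<And>z. z \<in> unit_disc \<Longrightarrow> Re (q z) > 1/2"
    using assms(1) by (auto simp: class_P_half_def class_P_def)
  have nz: "q w \<noteq> 0" if "norm w < 1" for w using q(3)[of w] that by auto
  have z2: "(norm z)\<^sup>2 < 1" using assms by (simp add: abs_square_less_1)
  define u where "u = (\<lambda>w. 1 / q w - 1)"
  have u_hol: "u holomorphic_on unit_disc"
    unfolding u_def by (intro holomorphic_intros q) (use nz in auto)
  have u_lt: "norm (u w) < 1" if "norm w < 1" for w
  proof -
    have "Re (q w) > 1/2" using q(3) that by simp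
    then have "(norm (1 - q w))\<^sup>2 < (norm (q w))\<^sup>2"
      by (simp only: cmod_power2) (simp add: power2_eq_square algebra_simps)
    then have "norm (1 - q w) < norm (q w)"
      using power_less_imp_less_base norm_ge_zero by blast
    moreover have "u w = (1 - q w) / q w" using nz[OF that] by (simp add: u_def field_simps)
    ultimately show ?thesis using nz[OF that] by (simp only: norm_divide) (simp add: divide_simps)
  qed
  have "norm (u z) \<le> norm z"
    using Schwarz_Lemma(1)[OF u_hol _ u_lt assms(2)] q(2) by (simp add: u_def)
  moreover have "1 - norm (u z) \<le> norm (1 / q z)"
    using norm_triangle_ineq4[of "1 / q z" "u z"] by (simp add: u_def)
  ultimately have q_up: "1 - norm z \<le> 1 / norm (q z)" by (simp add: norm_divide)
  have qz: "norm (q z) > 0" using nz[OF assms(2)] by simp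
  have der: "deriv (\<lambda>w. 2 * q w - 1) z = 2 * deriv q z"
    by (rule DERIV_imp_deriv)
       (rule derivative_eq_intros holomorphic_derivI[OF q(1)] refl | use assms(2) in simp)+
  have "norm (deriv (\<lambda>w. 2 * q w - 1) z) * (1 - (norm z)\<^sup>2) \<le> 2 * Re (2 * q z - 1)"
    by (rule deriv_bound_Re_pos) (use q(3) assms(2) in \<open>auto simp: mult.commute intro!: holomorphic_intros q(1)\<close>)
  then have "norm (deriv q z) * (1 - (norm z)\<^sup>2) \<le> 2 * Re (q z) - 1"
    by (simp add: der norm_mult)
  also have "\<dots> \<le> 2 * norm (q z) - 1" using complex_Re_le_cmod[of "q z"] by simp
  also have "\<dots> = norm (q z) * (2 - 1 / norm (q z))" using qz by (simp add: field_simps)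
  also have "\<dots> \<le> norm (q z) * (1 + norm z)"
    using q_up qz by (intro mult_left_mono) auto
  finally have "norm (deriv q z) / norm (q z) \<le> (1 + norm z) / (1 - (norm z)\<^sup>2)"
    using qz z2 by (simp add: divide_simps mult_ac)
  from mult_left_mono[OF this norm_ge_zero[of z]] show ?thesis
    by (simp add: zlogd_def norm_mult norm_divide mult_ac)
qed

section \<open>Quotients with removable singularities filled in\<close>

text \<open>Where \<open>g\<close> vanishes, that is possibly at 0, the pointwise quotient is 0 in HOL; the filled-in value
  is its limit, which exists because \<open>h\<close> is continuous there.\<close>

lemma quot_eqI:
  assumes fgh: "\<And>z. z \<in> unit_disc \<Longrightarrow> f z = g z * h z"
    and nz: "\<And>z. z \<in> unit_disc \<Longrightarrow> z \<noteq> 0 \<Longrightarrow> g z \<noteq> 0"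
    and h: "h holomorphic_on unit_disc" and z: "z \<in> unit_disc"
  shows "quot f g z = h z"
  unfolding quot_def
proof (rule remove_sings_eqI)
  have "isCont h z"
    using h z continuous_on_interior[of unit_disc h z]
    by (simp add: holomorphic_on_imp_continuous_on)
  then have "h \<midarrow>z\<rightarrow> h z" by (rule isContD)
  moreover have "eventually (\<lambda>w. w \<in> unit_disc - {0, z}) (at z)"
  proof -
    have "eventually (\<lambda>w. w \<in> unit_disc - {0} - {z}) (at z)" if "z \<noteq> 0"
      using z that by (intro eventually_at_in_open) auto
    moreover have "eventually (\<lambda>w. w \<in> unit_disc - {z}) (at z)"
      using z by (intro eventually_at_in_open) auto
    ultimately show ?thesis by (cases "z = 0") (auto elim: eventually_mono)
  qed
  then have "eventually (\<lambda>w. h w = f w / g w) (at z)"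
    by eventually_elim (use fgh nz in auto)
  ultimately show "(\<lambda>w. f w / g w) \<midarrow>z\<rightarrow> h z"
    using tendsto_cong by force
qed

lemma mult_quot_eq:
  assumes "f holomorphic_on unit_disc" "g holomorphic_on unit_disc"
    "z \<in> unit_disc" "g z \<noteq> 0"
  shows "f z = g z * quot f g z"
proof -
  have "f analytic_on {z}" "g analytic_on {z}"
    using assms holomorphic_on_imp_analytic_at[of _ unit_disc] by auto
  then have "(\<lambda>w. f w / g w) analytic_on {z}"
    using assms(4) by (auto intro: analytic_on_divide)
  then show ?thesis using assms(4) by (simp add: quot_def)
qed

lemma class_P_nonzero: "p \<in> class_P \<Longrightarrow> z \<in> unit_disc \<Longrightarrow> p z \<noteq> 0"
  by (force simp: class_P_def)

lemma class_P_cong: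
  assumes "\<And>z. z \<in> unit_disc \<Longrightarrow> p z = q z"
  shows "p \<in> class_P \<longleftrightarrow> q \<in> class_P"
proof -
  have "p holomorphic_on unit_disc \<longleftrightarrow> q holomorphic_on unit_disc"
    using assms by (rule holomorphic_cong[OF refl])
  then show ?thesis using assms by (auto simp: class_P_def)
qed

lemma class_P_half_cong:
  assumes "\<And>z. z \<in> unit_disc \<Longrightarrow> p z = q z"
  shows "p \<in> class_P_half \<longleftrightarrow> q \<in> class_P_half"
  using class_P_cong[OF assms] assms by (auto simp: class_P_half_def)

text \<open>This replaces every quotient in the definitions of the classes by a product. The two classes
  allowed for \<open>C\<close> depend only on the values on the disc. At 0, where the quotient is not literally
  \<open>f 0 / g 0\<close>, the product formula holds because \<open>f\<close> and \<open>g\<close> both vanish.\<close>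

lemma quot_mem_iff:
  assumes C: "C \<in> {class_P, class_P_half}"
    and f: "f holomorphic_on unit_disc" "f 0 = 0"
    and g: "g holomorphic_on unit_disc" "g 0 = 0"
      "\<And>z. z \<in> unit_disc \<Longrightarrow> z \<noteq> 0 \<Longrightarrow> g z \<noteq> 0"
  shows "quot f g \<in> C \<longleftrightarrow> (\<exists>q\<in>C. \<forall>z\<in>unit_disc. f z = g z * q z)"
proof
  assume "quot f g \<in> C"
  moreover have "f z = g z * quot f g z" if "z \<in> unit_disc" for z
    using mult_quot_eq[OF f(1) g(1) that] g(3)[OF that] f(2) g(2) by (cases "z = 0") auto
  ultimately show "\<exists>q\<in>C. \<forall>z\<in>unit_disc. f z = g z * q z" by blast
next
  assume "\<exists>q\<in>C. \<forall>z\<in>unit_disc. f z = g z * q z"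
  then obtain q where q: "q \<in> C" "\<And>z. z \<in> unit_disc \<Longrightarrow> f z = g z * q z" by blast
  have "q holomorphic_on unit_disc"
    using q(1) C by (auto simp: class_P_def class_P_half_def)
  then have "quot f g z = q z" if "z \<in> unit_disc" for z
    using quot_eqI[of f g q z] q(2) g(3) that by blast
  then show "quot f g \<in> C"
    using q(1) C class_P_cong[of "quot f g" q] class_P_half_cong[of "quot f g" q] by auto
qed

lemma class_AI:
  assumes h: "h holomorphic_on unit_disc" "h 0 = 1"
    and F: "\<And>z. z \<in> unit_disc \<Longrightarrow> F z = z * h z"
  shows "F \<in> class_A"
proof -
  have "F holomorphic_on unit_disc"
    by (rule holomorphic_transform[where f = "\<lambda>z. z * h z"])
       (use F in \<open>auto intro!: holomorphic_intros h\<close>)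
  then show ?thesis
    using h F deriv_id_mult[OF h(1) F, of 0] by (auto simp: class_A_def)
qed

lemma quot_id_mult_mem_iff:
  assumes "C \<in> {class_P, class_P_half}" "f \<in> class_A" "p \<in> class_P"
  shows "quot f (\<lambda>z. z * p z) \<in> C \<longleftrightarrow> (\<exists>q\<in>C. \<forall>z\<in>unit_disc. f z = z * (p z * q z))"
proof -
  have "(\<lambda>z. z * p z) holomorphic_on unit_disc"
    using assms(3) by (auto simp: class_P_def intro!: holomorphic_intros)
  then have "quot f (\<lambda>z. z * p z) \<in> C \<longleftrightarrow> (\<exists>q\<in>C. \<forall>z\<in>unit_disc. f z = z * p z * q z)"
    using assms class_P_nonzero[OF assms(3)]
    by (intro quot_mem_iff) (simp_all add: class_A_def)
  then show ?thesis by (simp only: mult.assoc)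
qed

lemma class_G3_iff:
  "f \<in> class_G3 \<longleftrightarrow>
     f \<in> class_A \<and> (\<exists>p\<in>class_P. \<exists>q\<in>class_P. \<forall>z\<in>unit_disc. f z = z * (p z * q z))"
proof -
  have "quot f (\<lambda>z. z * p z) \<in> class_P \<longleftrightarrow>
      (\<exists>q\<in>class_P. \<forall>z\<in>unit_disc. f z = z * (p z * q z))"
    if "f \<in> class_A" "p \<in> class_P" for p
    using quot_id_mult_mem_iff[OF _ that] by simp
  then show ?thesis unfolding class_G3_def by blast
qed

text \<open>The intermediate function \<open>g\<close> is determined by the factors, \<open>g z = z * (p z * q z)\<close>, so it can be
  eliminated. The choice \<open>C = class_P\<close> describes \<open>class_G1\<close> and \<open>C = class_P_half\<close> describes
  \<open>class_G2\<close>.\<close>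

lemma two_step_quot_iff:
  assumes C: "C \<in> {class_P, class_P_half}" and f: "f \<in> class_A"
  shows "(\<exists>g\<in>class_A. \<exists>p\<in>class_P. quot f g \<in> class_P \<and> quot g (\<lambda>z. z * p z) \<in> C) \<longleftrightarrow>
     (\<exists>p\<in>class_P. \<exists>q\<in>C. \<exists>h\<in>class_P. \<forall>z\<in>unit_disc. f z = z * (p z * (q z * h z)))"
    (is "?L \<longleftrightarrow> ?R")
proof -
  have CP: "q \<in> class_P" if "q \<in> C" for q
    using C that by (auto simp: class_P_half_def)
  have 1: "quot g (\<lambda>z. z * p z) \<in> C \<longleftrightarrow> (\<exists>q\<in>C. \<forall>z\<in>unit_disc. g z = z * (p z * q z))"
    if "g \<in> class_A" "p \<in> class_P" for g p
    using quot_id_mult_mem_iff[OF C that] .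
  have 2: "quot f g \<in> class_P \<longleftrightarrow>
      (\<exists>h\<in>class_P. \<forall>z\<in>unit_disc. f z = z * (p z * (q z * h z)))"
    if "g \<in> class_A" "p \<in> class_P" "q \<in> C" "\<And>z. z \<in> unit_disc \<Longrightarrow> g z = z * (p z * q z)" for g p q
  proof -
    have "quot f g \<in> class_P \<longleftrightarrow> (\<exists>h\<in>class_P. \<forall>z\<in>unit_disc. f z = g z * h z)"
    proof (rule quot_mem_iff)
      fix z :: complex assume "z \<in> unit_disc" "z \<noteq> 0"
      then show "g z \<noteq> 0"
        using that(4) class_P_nonzero[OF that(2)] class_P_nonzero[OF CP[OF that(3)]] by simp
    qed (use that(1) f in \<open>simp_all add: class_A_def\<close>)
    also have "\<dots> \<longleftrightarrow> (\<exists>h\<in>class_P. \<forall>z\<in>unit_disc. f z = z * (p z * (q z * h z)))"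
      using that(4) by (simp add: mult.assoc)
    finally show ?thesis .
  qed
  show ?thesis
  proof
    assume ?L
    then obtain g p where gp: "g \<in> class_A" "p \<in> class_P" "quot f g \<in> class_P"
      "quot g (\<lambda>z. z * p z) \<in> C" by blast
    then obtain q where q: "q \<in> C" "\<And>z. z \<in> unit_disc \<Longrightarrow> g z = z * (p z * q z)"
      using 1 by blast
    then show ?R using 2[OF gp(1,2) q] gp(2,3) by blast
  next
    assume ?R
    then obtain p q h where pqh: "p \<in> class_P" "q \<in> C" "h \<in> class_P"
      "\<forall>z\<in>unit_disc. f z = z * (p z * (q z * h z))" by blast
    have g: "(\<lambda>z. z * (p z * q z)) \<in> class_A"
      using pqh(1) CP[OF pqh(2)]
      by (intro class_AI[where h = "\<lambda>z. p z * q z"]) (auto simp: class_P_def intro!: holomorphic_intros)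
    show ?L
    proof (intro bexI conjI)
      show "quot (\<lambda>z. z * (p z * q z)) (\<lambda>z. z * p z) \<in> C"
        unfolding 1[OF g pqh(1)] using pqh(2) by blast
      show "quot f (\<lambda>z. z * (p z * q z)) \<in> class_P"
        unfolding 2[OF g pqh(1,2) refl] using pqh(3,4) by blast
    qed (fact g pqh(1))+
  qed
qed

lemma class_G1_iff:
  "f \<in> class_G1 \<longleftrightarrow> f \<in> class_A \<and> (\<exists>p\<in>class_P. \<exists>q\<in>class_P. \<exists>h\<in>class_P.
     \<forall>z\<in>unit_disc. f z = z * (p z * (q z * h z)))"
  using two_step_quot_iff[of class_P f] unfolding class_G1_def by blast

lemma class_G2_iff:
  "f \<in> class_G2 \<longleftrightarrow> f \<in> class_A \<and> (\<exists>p\<in>class_P. \<exists>q\<in>class_P_half. \<exists>h\<in>class_P.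
     \<forall>z\<in>unit_disc. f z = z * (p z * (q z * h z)))"
  using two_step_quot_iff[of class_P_half f] unfolding class_G2_def by blast

section \<open>The radius criterion\<close>

lemma lemniscate_disc:
  assumes "norm (W - 1) < sqrt 2 - 1"
  shows "norm (W\<^sup>2 - 1) < 1" and "Re W > 0"
proof -
  have "norm (W + 1) \<le> norm (W - 1) + norm (2::complex)"
    using norm_triangle_ineq[of "W - 1" 2] by (simp add: add.commute)
  then have "norm (W + 1) < sqrt 2 + 1" using assms by simp
  then have "norm (W - 1) * norm (W + 1) < (sqrt 2 - 1) * (sqrt 2 + 1)"
    using assms by (intro mult_strict_mono') auto
  then show "norm (W\<^sup>2 - 1) < 1"
    by (simp add: norm_mult [symmetric] power2_eq_square algebra_simps)
  have "sqrt 2 < (2::real)" by (simp add: real_less_lsqrt)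
  then show "Re W > 0" using abs_Re_le_cmod[of "W - 1"] assms by simp
qed

text \<open>With \<open>W = z F'/F\<close>, the Schwarz function that realises the subordination is \<open>W\<^sup>2 - 1\<close>: it maps into
  the disc since \<open>W\<close> takes values in the lemniscate region, and \<open>csqrt (W\<^sup>2) = W\<close> since \<open>Re W > 0\<close>.\<close>

lemma lemniscate_starlikeI:
  assumes h: "h holomorphic_on unit_disc" "h 0 = 1" "\<And>z. z \<in> unit_disc \<Longrightarrow> h z \<noteq> 0"
    and F: "\<And>z. z \<in> unit_disc \<Longrightarrow> F z = z * h z"
    and bound: "\<And>z. z \<in> unit_disc \<Longrightarrow> norm (zlogd h z) < sqrt 2 - 1"
  shows "F \<in> lemniscate_starlike"
proof -
  define W where "W = (\<lambda>z. 1 + zlogd h z)"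
  have W_hol: "W holomorphic_on unit_disc"
    unfolding W_def zlogd_def by (intro holomorphic_intros h) (use h in auto)
  have "z * deriv F z = F z * W z" if "z \<in> unit_disc" for z
    using mult_deriv_id_mult[OF h(1) F that h(3)[OF that]] by (simp add: W_def)
  then have quot_W: "quot (\<lambda>z. z * deriv F z) F z = W z" if "z \<in> unit_disc" for z
    using that h(3) W_hol by (intro quot_eqI) (auto simp: F)
  have lem: "norm ((W z)\<^sup>2 - 1) < 1" "Re (W z) > 0" if "z \<in> unit_disc" for z
    using lemniscate_disc[of "W z"] bound[OF that] by (auto simp: W_def)
  have "csqrt (1 + ((W z)\<^sup>2 - 1)) = W z" if "z \<in> unit_disc" for z
    using lem(2)[OF that] by (simp add: csqrt_square)
  moreover have "(\<lambda>z. csqrt (1 + z)) holomorphic_on unit_disc"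
  proof (intro holomorphic_intros)
    fix z :: complex assume "z \<in> unit_disc"
    then show "1 + z \<notin> \<real>\<^sub>\<le>\<^sub>0"
      using abs_Re_le_cmod[of z] by (auto simp: complex_nonpos_Reals_iff)
  qed
  moreover have "(\<lambda>z. (W z)\<^sup>2 - 1) holomorphic_on unit_disc"
    by (intro holomorphic_intros W_hol)
  moreover have "quot (\<lambda>z. z * deriv F z) F holomorphic_on unit_disc"
    using W_hol quot_W by (metis holomorphic_transform)
  moreover have "(W 0)\<^sup>2 - 1 = 0" by (simp add: W_def zlogd_def)
  ultimately have "subordinate (quot (\<lambda>z. z * deriv F z) F) (\<lambda>z. csqrt (1 + z))"
    unfolding subordinate_def
    by (intro conjI exI[of _ "\<lambda>z. (W z)\<^sup>2 - 1"]) (auto simp: lem quot_W)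
  moreover have "F \<in> class_A" by (rule class_AI[OF h(1,2) F])
  ultimately show ?thesis by (simp add: lemniscate_starlike_def starlike_class_def)
qed

lemma lemniscate_starlikeD:
  assumes F: "F \<in> lemniscate_starlike" and z: "z \<in> unit_disc" "F z \<noteq> 0"
  shows "norm ((z * deriv F z / F z)\<^sup>2 - 1) < 1"
proof -
  have hol: "F holomorphic_on unit_disc"
    using F by (simp add: lemniscate_starlike_def starlike_class_def class_A_def)
  obtain w where w: "w ` unit_disc \<subseteq> unit_disc"
    "\<forall>z\<in>unit_disc. quot (\<lambda>z. z * deriv F z) F z = csqrt (1 + w z)"
    using F by (auto simp: lemniscate_starlike_def starlike_class_def subordinate_def)
  have "z * deriv F z = F z * quot (\<lambda>z. z * deriv F z) F z"
    using hol z by (intro mult_quot_eq holomorphic_intros) auto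
  then have "z * deriv F z / F z = csqrt (1 + w z)" using w z by (simp add: field_simps)
  then have "(z * deriv F z / F z)\<^sup>2 - 1 = w z" by simp
  moreover have "w z \<in> unit_disc" using w(1) z(1) by blast
  ultimately show ?thesis by simp
qed

text \<open>After multiplication by \<open>1 - x\<^sup>2\<close>, comparing the fraction with \<open>c\<close> amounts to comparing
  \<open>(b + c) x\<^sup>2 + a x\<close> with \<open>c\<close>. The left-hand side increases in \<open>x \<ge> 0\<close> and equals \<open>c\<close> at \<open>R\<close>.\<close>

lemma quadratic_threshold:
  fixes R a b c x :: real
  assumes a: "0 < a" and b: "0 \<le> b" and c: "0 < c" and R: "0 < R"
    and root: "(b + c) * R\<^sup>2 + a * R = c"
  shows "R < 1"
    and "0 \<le> x \<Longrightarrow> x < R \<Longrightarrow> (a * x + b * x\<^sup>2) / (1 - x\<^sup>2) < c"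
    and "R < x \<Longrightarrow> x < 1 \<Longrightarrow> c \<le> (a * x + b * x\<^sup>2) / (1 - x\<^sup>2)"
proof -
  have mono: "(b + c) * s\<^sup>2 + a * s < (b + c) * t\<^sup>2 + a * t" if "0 \<le> s" "s < t" for s t
    using a b c that by (intro add_strict_mono mult_strict_left_mono power_strict_mono) auto
  show R1: "R < 1"
  proof (rule ccontr)
    assume "\<not> R < 1"
    then have "(b + c) * 1\<^sup>2 + a * 1 \<le> (b + c) * R\<^sup>2 + a * R"
      using mono[of 1 R] by (cases "R = 1") auto
    then show False using root a b by simp
  qed
  show "(a * x + b * x\<^sup>2) / (1 - x\<^sup>2) < c" if "0 \<le> x" "x < R"
  proof -
    have "x\<^sup>2 < 1" using that R1 by (simp add: abs_square_less_1)
    then show ?thesis using mono[OF that] root by (simp add: divide_simps algebra_simps)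
  qed
  show "c \<le> (a * x + b * x\<^sup>2) / (1 - x\<^sup>2)" if "R < x" "x < 1"
  proof -
    have "x\<^sup>2 < 1" using that R by (simp add: abs_square_less_1)
    then show ?thesis using mono[of R x] R that root by (simp add: divide_simps algebra_simps)
  qed
qed

lemma norm_scale_less:
  fixes z :: complex
  assumes "0 < r" "r < R" "norm z < 1"
  shows "norm (of_real r * z) < R"
proof -
  have "norm (of_real r * z) = r * norm z" using assms by (simp add: norm_mult)
  also have "\<dots> \<le> r * 1" using assms by (intro mult_left_mono) auto
  finally show ?thesis using assms by simp
qed

text \<open>The function \<open>\<beta>\<close> bounds \<open>|z f'/f - 1|\<close> over the family, and \<open>k\<close> attains it at positive real
  points. For a dilation \<open>z \<mapsto> f (r z) / r\<close> the logarithmic derivative is that of \<open>f\<close> at \<open>r z\<close>, so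
  everything depends on whether \<open>\<beta>\<close> is below \<open>sqrt 2 - 1\<close>, which holds exactly on \<open>[0, R)\<close>. If some
  larger \<open>R'\<close> were admissible, the dilation of \<open>z * k z\<close> by an \<open>r\<close> with \<open>R < r < R'\<close> would still have
  a point \<open>x / r\<close> of the disc with \<open>R < x < r\<close>. There the value \<open>1 + \<beta> x \<ge> sqrt 2\<close> lies outside the
  lemniscate region.\<close>

lemma is_radius_lemniscateI:
  fixes a b R :: real
  defines "\<beta> \<equiv> \<lambda>x. (a * x + b * x\<^sup>2) / (1 - x\<^sup>2)"
  assumes ab: "0 < a" "0 \<le> b" and R: "0 < R" "(b + (sqrt 2 - 1)) * R\<^sup>2 + a * R = sqrt 2 - 1"
    and fact: "\<And>f. f \<in> F \<Longrightarrow> \<exists>h. h holomorphic_on unit_disc \<and> h 0 = 1 \<and>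
       (\<forall>z\<in>unit_disc. h z \<noteq> 0 \<and> f z = z * h z \<and> norm (zlogd h z) \<le> \<beta> (norm z))"
    and ext: "(\<lambda>z. z * k z) \<in> F" "k holomorphic_on unit_disc" "\<And>z. z \<in> unit_disc \<Longrightarrow> k z \<noteq> 0"
      "\<And>x::real. 0 < x \<Longrightarrow> x < 1 \<Longrightarrow> zlogd k (of_real x) = of_real (\<beta> x)"
  shows "is_radius lemniscate_starlike F R"
proof -
  have R1: "R < 1" by (rule quadratic_threshold(1)[OF ab _ R]) simp
  have thr: "\<beta> x < sqrt 2 - 1" if "0 \<le> x" "x < R" for x
    unfolding \<beta>_def by (rule quadratic_threshold(2)[OF ab _ R that]) simp
  have thr': "sqrt 2 - 1 \<le> \<beta> x" if "R < x" "x < 1" for x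
    unfolding \<beta>_def by (rule quadratic_threshold(3)[OF ab _ R that]) simp
  have "(\<lambda>z. f (of_real r * z) / of_real r) \<in> lemniscate_starlike"
    if f: "f \<in> F" and r: "0 < r" "r < R" for f and r :: real
  proof -
    obtain h where h: "h holomorphic_on unit_disc" "h 0 = 1"
      "\<And>z. z \<in> unit_disc \<Longrightarrow> h z \<noteq> 0" "\<And>z. z \<in> unit_disc \<Longrightarrow> f z = z * h z"
      "\<And>z. z \<in> unit_disc \<Longrightarrow> norm (zlogd h z) \<le> \<beta> (norm z)"
      using fact[OF f] by metis
    have rz: "norm (of_real r * z) < R" if "z \<in> unit_disc" for z :: complex
      using norm_scale_less[OF r] that by simp
    then have rz1: "of_real r * z \<in> unit_disc" if "z \<in> unit_disc" for z :: complex
      using R1 that by fastforce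
    show ?thesis
    proof (rule lemniscate_starlikeI[where h = "\<lambda>z. h (of_real r * z)"])
      show "(\<lambda>z. h (of_real r * z)) holomorphic_on unit_disc"
        using rz1 by (intro holomorphic_on_compose_gen[OF _ h(1), unfolded o_def] holomorphic_intros) auto
      fix z :: complex assume z: "z \<in> unit_disc"
      show "f (of_real r * z) / of_real r = z * h (of_real r * z)"
        using h(4)[OF rz1[OF z]] r by simp
      have "norm (zlogd h (of_real r * z)) \<le> \<beta> (norm (of_real r * z))"
        by (rule h(5)[OF rz1[OF z]])
      also have "\<dots> < sqrt 2 - 1"
        by (rule thr) (use rz[OF z] in auto)
      finally show "norm (zlogd (\<lambda>z. h (of_real r * z)) z) < sqrt 2 - 1"
        by (simp add: zlogd_scale[OF h(1) rz1[OF z]])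
    qed (use h rz1 in auto)
  qed
  then have "R \<in> admissible_radii lemniscate_starlike F"
    using R R1 by (auto simp: admissible_radii_def)
  moreover have "R' \<le> R" if R': "R' \<in> admissible_radii lemniscate_starlike F" for R'
  proof (rule ccontr)
    assume "\<not> R' \<le> R"
    define r where "r = (R + R') / 2"
    define x where "x = (R + r) / 2"
    have r: "R < r" "r < R'" and x: "R < x" "x < r"
      using \<open>\<not> R' \<le> R\<close> by (auto simp: r_def x_def)
    have R'1: "R' < 1" using R' by (simp add: admissible_radii_def)
    define G where "G = (\<lambda>z. (of_real r * z) * k (of_real r * z) / of_real r)"
    have G_lem: "G \<in> lemniscate_starlike"
      using R' ext(1) r R by (auto simp: admissible_radii_def G_def)
    define t where "t = complex_of_real (x / r)"
    have rt: "of_real r * t = of_real x" using r R by (simp add: t_def)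
    have t: "t \<in> unit_disc" "t \<noteq> 0"
      using r x R by (auto simp: t_def norm_divide)
    have rz: "of_real r * z \<in> unit_disc" if "z \<in> unit_disc" for z :: complex
      using norm_scale_less[of r 1 z] r R R'1 that by simp
    have hol: "(\<lambda>z. k (of_real r * z)) holomorphic_on unit_disc"
      using rz by (intro holomorphic_on_compose_gen[OF _ ext(2), unfolded o_def] holomorphic_intros) auto
    have nz: "k (of_real r * t) \<noteq> 0" using ext(3) rz t by blast
    have Gt: "G t \<noteq> 0" using nz t r R by (simp add: G_def)
    have "t * deriv G t = G t * (1 + zlogd (\<lambda>z. k (of_real r * z)) t)"
      by (rule mult_deriv_id_mult[OF hol _ t(1) nz]) (use r R in \<open>auto simp: G_def\<close>)
    also have "zlogd (\<lambda>z. k (of_real r * z)) t = of_real (\<beta> x)"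
      using zlogd_scale[OF ext(2) rz[OF t(1)]] ext(4)[of x] x r R R'1 by (simp add: rt)
    finally have "t * deriv G t / G t = of_real (1 + \<beta> x)" using Gt by simp
    then have "norm ((complex_of_real (1 + \<beta> x))\<^sup>2 - 1) < 1"
      using lemniscate_starlikeD[OF G_lem t(1) Gt] by simp
    then have "norm (complex_of_real ((1 + \<beta> x)\<^sup>2 - 1)) < 1" by simp
    then have "(1 + \<beta> x)\<^sup>2 - 1 < 1" by (simp only: norm_of_real)
    moreover have "sqrt 2 - 1 \<le> \<beta> x" using thr' x r R'1 by simp
    then have "(sqrt 2)\<^sup>2 \<le> (1 + \<beta> x)\<^sup>2" by (intro power_mono) auto
    ultimately show False by simp
  qed
  ultimately show ?thesis unfolding is_radius_def by blast
qed

section \<open>The extremal functions\<close>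

lemma half_plane_map_class_P: "(\<lambda>z. (1 + z) / (1 - z)) \<in> class_P"
proof -
  have "Re ((1 + z) / (1 - z)) > 0" if "norm z < 1" for z :: complex
  proof -
    have "z \<noteq> 1" using that by auto
    have "(norm z)\<^sup>2 < 1" using that by (simp add: abs_square_less_1)
    have "(1 + z) / (1 - z) = (1 + z) * cnj (1 - z) / of_real ((norm (1 - z))\<^sup>2)"
      using complex_div_cnj[of "1 + z" "1 - z"] by (simp only: of_real_power)
    then have "Re ((1 + z) / (1 - z)) = Re ((1 + z) * cnj (1 - z)) / (norm (1 - z))\<^sup>2"
      by (simp only: Re_divide_of_real)
    moreover have "Re ((1 + z) * cnj (1 - z)) = 1 - (norm z)\<^sup>2"
      by (simp only: cmod_power2) (simp add: power2_eq_square algebra_simps)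
    ultimately show ?thesis using \<open>z \<noteq> 1\<close> \<open>(norm z)\<^sup>2 < 1\<close> by simp
  qed
  moreover have "(\<lambda>z::complex. (1 + z) / (1 - z)) holomorphic_on unit_disc"
    by (intro holomorphic_intros) auto
  ultimately show ?thesis by (simp add: class_P_def)
qed

lemma geometric_class_P_half: "(\<lambda>z. 1 / (1 - z)) \<in> class_P_half"
proof -
  have half: "Re (1 / (1 - z)) > 1 / 2" if "norm z < 1" for z
  proof -
    have "1 - z \<noteq> 0" using that by auto
    define v where "v = (1 + z) / (1 - z)"
    have "1 / (1 - z) = (1 + v) / 2" using \<open>1 - z \<noteq> 0\<close> by (simp add: v_def divide_simps)
    then have "Re (1 / (1 - z)) = (1 + Re v) / 2" by (simp only:) simp
    moreover have "Re v > 0"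
      using half_plane_map_class_P that by (simp add: class_P_def v_def)
    ultimately show ?thesis by simp
  qed
  moreover have "Re (1 / (1 - z)) > 0" if "norm z < 1" for z
    using half[OF that] by linarith
  moreover have "(\<lambda>z::complex. 1 / (1 - z)) holomorphic_on unit_disc"
    by (intro holomorphic_intros) auto
  ultimately show ?thesis
    unfolding class_P_half_def class_P_def by simp
qed

lemma zlogd_half_plane_map:
  assumes "0 < x" "x < 1"
  shows "zlogd (\<lambda>z. (1 + z) / (1 - z)) (of_real x) = of_real (2 * x / (1 - x\<^sup>2))"
proof -
  define u where "u = complex_of_real x"
  have nz: "1 - u \<noteq> 0" "1 + u \<noteq> 0"
    using assms by (auto simp: u_def complex_eq_iff)
  have "((\<lambda>z. (1 + z) / (1 - z)) has_field_derivative 2 / (1 - u)\<^sup>2) (at u)"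
    using nz by (auto intro!: derivative_eq_intros simp: power2_eq_square)
  then have "deriv (\<lambda>z. (1 + z) / (1 - z)) u = 2 / (1 - u)\<^sup>2"
    by (rule DERIV_imp_deriv)
  moreover have "1 - u\<^sup>2 = (1 - u) * (1 + u)" by (simp add: power2_eq_square algebra_simps)
  ultimately have "zlogd (\<lambda>z. (1 + z) / (1 - z)) u = 2 * u / (1 - u\<^sup>2)"
    using nz by (simp add: zlogd_def power2_eq_square)
  then show ?thesis by (simp add: u_def)
qed

lemma zlogd_geometric:
  assumes "0 < x" "x < 1"
  shows "zlogd (\<lambda>z. 1 / (1 - z)) (of_real x) = of_real (x * (1 + x) / (1 - x\<^sup>2))"
proof -
  define u where "u = complex_of_real x"
  have nz: "1 - u \<noteq> 0" "1 + u \<noteq> 0"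
    using assms by (auto simp: u_def complex_eq_iff)
  have "((\<lambda>z. 1 / (1 - z)) has_field_derivative 1 / (1 - u)\<^sup>2) (at u)"
    using nz by (auto intro!: derivative_eq_intros simp: power2_eq_square)
  then have "deriv (\<lambda>z. 1 / (1 - z)) u = 1 / (1 - u)\<^sup>2"
    by (rule DERIV_imp_deriv)
  moreover have "1 - u\<^sup>2 = (1 - u) * (1 + u)" by (simp add: power2_eq_square algebra_simps)
  ultimately have "zlogd (\<lambda>z. 1 / (1 - z)) u = u * (1 + u) / (1 - u\<^sup>2)"
    using nz by (simp add: zlogd_def power2_eq_square)
  then show ?thesis by (simp add: u_def)
qed
lemma zlogd_mult_class_P:
  assumes "p \<in> class_P" "q \<in> class_P" "z \<in> unit_disc"
  shows "zlogd (\<lambda>w. p w * q w) z = zlogd p z + zlogd q z"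
  using assms by (intro zlogd_mult) (auto simp: class_P_def class_P_nonzero)

lemma zlogd_mult3_class_P:
  assumes "p \<in> class_P" "q \<in> class_P" "h \<in> class_P" "z \<in> unit_disc"
  shows "zlogd (\<lambda>w. p w * (q w * h w)) z = zlogd p z + (zlogd q z + zlogd h z)"
proof -
  have "zlogd (\<lambda>w. p w * (q w * h w)) z = zlogd p z + zlogd (\<lambda>w. q w * h w) z"
    using assms by (intro zlogd_mult) (auto simp: class_P_def class_P_nonzero intro!: holomorphic_intros)
  then show ?thesis using assms by (simp add: zlogd_mult_class_P)
qed

section \<open>The three radii\<close>

text \<open>This is the positive root from the quadratic formula with the surd moved to the denominator, the
  form in which the three radii are stated. With \<open>s\<close> for the square root, the claim follows from
  \<open>R (d + s) = c\<close> and \<open>c (b + c) + 2 d (d + s) = (d + s)\<^sup>2\<close>.\<close>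

lemma quadratic_root:
  fixes b c d :: real
  assumes "0 \<le> b" "0 < c" "0 < d"
  defines "R \<equiv> c / (d + sqrt (d\<^sup>2 + c * (b + c)))"
  shows "0 < R" and "(b + c) * R\<^sup>2 + (2 * d) * R = c"
proof -
  define s where "s = sqrt (d\<^sup>2 + c * (b + c))"
  have s2: "s\<^sup>2 = d\<^sup>2 + c * (b + c)" using assms by (simp add: s_def)
  have "0 \<le> s" using assms by (simp add: s_def)
  then have ds: "0 < d + s" using assms by simp
  show "0 < R" using ds assms by (simp add: R_def s_def)
  have R: "R * (d + s) = c" using ds by (simp add: R_def s_def)
  have "((b + c) * R\<^sup>2 + (2 * d) * R) * (d + s)\<^sup>2 =
      (b + c) * (R * (d + s))\<^sup>2 + 2 * d * (R * (d + s)) * (d + s)"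
    by (simp add: power2_eq_square algebra_simps)
  also have "\<dots> = c * (c * (b + c) + 2 * d * (d + s))"
    unfolding R by (simp add: power2_eq_square algebra_simps)
  also have "c * (b + c) + 2 * d * (d + s) = (d + s)\<^sup>2"
    using s2 by (simp add: power2_eq_square algebra_simps)
  finally show "(b + c) * R\<^sup>2 + (2 * d) * R = c" using ds by simp
qed

lemma is_radius_G1:
  "is_radius lemniscate_starlike class_G1
     ((3 - 2 * sqrt 2) / ((sqrt 2 - 1) * (3 + sqrt (12 - 2 * sqrt 2))))"
proof -
  let ?c = "sqrt 2 - 1 :: real" and ?m = "\<lambda>z::complex. (1 + z) / (1 - z)"
  have c: "0 < ?c" "3 - 2 * sqrt 2 = ?c * ?c" by (auto simp: algebra_simps)
  have R: "(3 - 2 * sqrt 2) / (?c * (3 + sqrt (12 - 2 * sqrt 2))) =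
      ?c / (3 + sqrt (3\<^sup>2 + ?c * (0 + ?c)))"
  proof -
    have "12 - 2 * sqrt 2 = 3\<^sup>2 + ?c * (0 + ?c)" by (simp add: algebra_simps)
    moreover have "?c \<noteq> 0" using c(1) by linarith
    ultimately show ?thesis by (simp only: c(2) mult_divide_mult_cancel_left simp_thms)
  qed
  show ?thesis unfolding R
  proof (rule is_radius_lemniscateI[where a = "2 * 3" and b = 0 and k = "\<lambda>z. ?m z * (?m z * ?m z)"])
    fix f assume "f \<in> class_G1"
    then obtain p q h where pqh: "p \<in> class_P" "q \<in> class_P" "h \<in> class_P"
        "\<forall>z\<in>unit_disc. f z = z * (p z * (q z * h z))"
      by (auto simp: class_G1_iff)
    show "\<exists>h. h holomorphic_on unit_disc \<and> h 0 = 1 \<and> (\<forall>z\<in>unit_disc. h z \<noteq> 0 \<and> f z = z * h z \<and>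
        norm (zlogd h z) \<le> (2 * 3 * norm z + 0 * (norm z)\<^sup>2) / (1 - (norm z)\<^sup>2))"
    proof (intro exI[of _ "\<lambda>z. p z * (q z * h z)"] conjI ballI)
      fix z assume z: "z \<in> unit_disc"
      let ?B = "2 * norm z / (1 - (norm z)\<^sup>2)"
      have "norm (zlogd p z + (zlogd q z + zlogd h z)) \<le> ?B + (?B + ?B)"
        using z by (intro norm_triangle_mono zlogd_bound_class_P pqh) auto
      also have "?B + (?B + ?B) = (2 * 3 * norm z + 0 * (norm z)\<^sup>2) / (1 - (norm z)\<^sup>2)"
        by (simp add: add_divide_distrib [symmetric])
      finally show "norm (zlogd (\<lambda>z. p z * (q z * h z)) z) \<le> \<dots>"
        using zlogd_mult3_class_P[OF pqh(1-3) z] by simp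
    qed (use pqh in \<open>auto simp: class_P_def class_P_nonzero intro!: holomorphic_intros\<close>)
  next
    have "(\<lambda>z. z * (?m z * (?m z * ?m z))) \<in> class_A"
      by (rule class_AI[where h = "\<lambda>z. ?m z * (?m z * ?m z)"]) (auto intro!: holomorphic_intros)
    then show "(\<lambda>z. z * (?m z * (?m z * ?m z))) \<in> class_G1"
      unfolding class_G1_iff
      by (intro conjI bexI[of _ ?m, OF bexI[of _ ?m, OF bexI[of _ ?m]]] ballI refl
          half_plane_map_class_P)
  next
    fix x :: real assume x: "0 < x" "x < 1"
    then have "complex_of_real x \<in> unit_disc" by simp
    from zlogd_mult3_class_P[OF half_plane_map_class_P half_plane_map_class_P half_plane_map_class_P this]
    show "zlogd (\<lambda>z. ?m z * (?m z * ?m z)) (of_real x) =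
        of_real ((2 * 3 * x + 0 * x\<^sup>2) / (1 - x\<^sup>2))"
      by (simp add: zlogd_half_plane_map[OF x] add_divide_distrib [symmetric])
  next
    fix z :: complex assume "z \<in> unit_disc"
    then show "?m z * (?m z * ?m z) \<noteq> 0"
      using class_P_nonzero[OF half_plane_map_class_P] by simp
  qed (use quadratic_root[of 0 ?c 3] c in \<open>auto intro!: holomorphic_intros\<close>)
qed

lemma is_radius_G2:
  "is_radius lemniscate_starlike class_G2 (2 * (sqrt 2 - 1) / (5 + sqrt (33 - 4 * sqrt 2)))"
proof -
  let ?c = "sqrt 2 - 1 :: real" and ?m = "\<lambda>z::complex. (1 + z) / (1 - z)"
    and ?q = "\<lambda>z::complex. 1 / (1 - z)"
  have PH: "q \<in> class_P" if "q \<in> class_P_half" for q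
    using that by (simp add: class_P_half_def)
  have c: "0 < ?c" by simp
  \<comment> \<open>the linear coefficient 5 is odd, so the root formula has \<open>d = 5/2\<close> and the surd is halved\<close>
  have "33 - 4 * sqrt 2 = 2\<^sup>2 * ((5/2)\<^sup>2 + ?c * (1 + ?c))"
    by (simp add: power2_eq_square algebra_simps)
  then have "sqrt (33 - 4 * sqrt 2) = 2 * sqrt ((5/2)\<^sup>2 + ?c * (1 + ?c))"
    by (simp only: real_sqrt_mult) simp
  then have R: "2 * ?c / (5 + sqrt (33 - 4 * sqrt 2)) =
      ?c / (5/2 + sqrt ((5/2)\<^sup>2 + ?c * (1 + ?c)))"
    by (simp only:) (simp add: field_simps)
  show ?thesis unfolding R
  proof (rule is_radius_lemniscateI[where a = "2 * (5/2)" and b = 1 and k = "\<lambda>z. ?m z * (?q z * ?m z)"])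
    fix f assume "f \<in> class_G2"
    then obtain p q h where pqh: "p \<in> class_P" "q \<in> class_P_half" "h \<in> class_P"
        "\<forall>z\<in>unit_disc. f z = z * (p z * (q z * h z))"
      by (auto simp: class_G2_iff)
    show "\<exists>h. h holomorphic_on unit_disc \<and> h 0 = 1 \<and> (\<forall>z\<in>unit_disc. h z \<noteq> 0 \<and> f z = z * h z \<and>
        norm (zlogd h z) \<le> (2 * (5/2) * norm z + 1 * (norm z)\<^sup>2) / (1 - (norm z)\<^sup>2))"
    proof (intro exI[of _ "\<lambda>z. p z * (q z * h z)"] conjI ballI)
      fix z assume z: "z \<in> unit_disc"
      let ?B = "2 * norm z / (1 - (norm z)\<^sup>2)"
        and ?B' = "norm z * (1 + norm z) / (1 - (norm z)\<^sup>2)"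
      have "norm (zlogd p z + (zlogd q z + zlogd h z)) \<le> ?B + (?B' + ?B)"
        using z by (intro norm_triangle_mono zlogd_bound_class_P zlogd_bound_class_P_half pqh) auto
      also have "?B + (?B' + ?B) = (2 * (5/2) * norm z + 1 * (norm z)\<^sup>2) / (1 - (norm z)\<^sup>2)"
        by (simp add: add_divide_distrib [symmetric] power2_eq_square algebra_simps)
      finally show "norm (zlogd (\<lambda>z. p z * (q z * h z)) z) \<le> \<dots>"
        using zlogd_mult3_class_P[OF pqh(1) PH[OF pqh(2)] pqh(3) z] by simp
    qed (use pqh PH[OF pqh(2)] in \<open>auto simp: class_P_def class_P_nonzero intro!: holomorphic_intros\<close>)
  next
    have "(\<lambda>z. z * (?m z * (?q z * ?m z))) \<in> class_A"
      by (rule class_AI[where h = "\<lambda>z. ?m z * (?q z * ?m z)"]) (auto intro!: holomorphic_intros)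
    then show "(\<lambda>z. z * (?m z * (?q z * ?m z))) \<in> class_G2"
      unfolding class_G2_iff
      by (intro conjI bexI[of _ ?m, OF bexI[of _ ?q, OF bexI[of _ ?m]]] ballI refl
          half_plane_map_class_P geometric_class_P_half)
  next
    fix x :: real assume x: "0 < x" "x < 1"
    then have "complex_of_real x \<in> unit_disc" by simp
    from zlogd_mult3_class_P[OF half_plane_map_class_P PH[OF geometric_class_P_half] half_plane_map_class_P this]
    have "zlogd (\<lambda>z. ?m z * (?q z * ?m z)) (of_real x) =
        of_real (2 * x / (1 - x\<^sup>2) + (x * (1 + x) / (1 - x\<^sup>2) + 2 * x / (1 - x\<^sup>2)))"
      by (simp only: zlogd_half_plane_map[OF x] zlogd_geometric[OF x] of_real_add)
    also have "2 * x / (1 - x\<^sup>2) + (x * (1 + x) / (1 - x\<^sup>2) + 2 * x / (1 - x\<^sup>2)) =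
        (2 * (5/2) * x + 1 * x\<^sup>2) / (1 - x\<^sup>2)"
      by (simp add: add_divide_distrib [symmetric] power2_eq_square algebra_simps)
    finally show "zlogd (\<lambda>z. ?m z * (?q z * ?m z)) (of_real x) = of_real \<dots>" .
  next
    fix z :: complex assume "z \<in> unit_disc"
    then show "?m z * (?q z * ?m z) \<noteq> 0"
      using class_P_nonzero[OF half_plane_map_class_P] class_P_nonzero[OF PH[OF geometric_class_P_half]]
      by simp
  qed (use quadratic_root[of 1 ?c "5/2"] c in \<open>auto intro!: holomorphic_intros\<close>)
qed

lemma is_radius_G3:
  "is_radius lemniscate_starlike class_G3
     ((3 - 2 * sqrt 2) / ((sqrt 2 - 1) * (2 + sqrt (7 - 2 * sqrt 2))))"
proof -
  let ?c = "sqrt 2 - 1 :: real" and ?m = "\<lambda>z::complex. (1 + z) / (1 - z)"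
  have c: "0 < ?c" "3 - 2 * sqrt 2 = ?c * ?c" by (auto simp: algebra_simps)
  have R: "(3 - 2 * sqrt 2) / (?c * (2 + sqrt (7 - 2 * sqrt 2))) =
      ?c / (2 + sqrt (2\<^sup>2 + ?c * (0 + ?c)))"
  proof -
    have "7 - 2 * sqrt 2 = 2\<^sup>2 + ?c * (0 + ?c)" by (simp add: algebra_simps)
    moreover have "?c \<noteq> 0" using c(1) by linarith
    ultimately show ?thesis by (simp only: c(2) mult_divide_mult_cancel_left simp_thms)
  qed
  show ?thesis unfolding R
  proof (rule is_radius_lemniscateI[where a = "2 * 2" and b = 0 and k = "\<lambda>z. ?m z * ?m z"])
    fix f assume "f \<in> class_G3"
    then obtain p q where pq: "p \<in> class_P" "q \<in> class_P"
        "\<forall>z\<in>unit_disc. f z = z * (p z * q z)"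
      by (auto simp: class_G3_iff)
    show "\<exists>h. h holomorphic_on unit_disc \<and> h 0 = 1 \<and> (\<forall>z\<in>unit_disc. h z \<noteq> 0 \<and> f z = z * h z \<and>
        norm (zlogd h z) \<le> (2 * 2 * norm z + 0 * (norm z)\<^sup>2) / (1 - (norm z)\<^sup>2))"
    proof (intro exI[of _ "\<lambda>z. p z * q z"] conjI ballI)
      fix z assume z: "z \<in> unit_disc"
      let ?B = "2 * norm z / (1 - (norm z)\<^sup>2)"
      have "norm (zlogd p z + zlogd q z) \<le> ?B + ?B"
        using z by (intro norm_triangle_mono zlogd_bound_class_P pq) auto
      also have "?B + ?B = (2 * 2 * norm z + 0 * (norm z)\<^sup>2) / (1 - (norm z)\<^sup>2)"
        by (simp add: add_divide_distrib [symmetric])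
      finally show "norm (zlogd (\<lambda>z. p z * q z) z) \<le> \<dots>"
        using zlogd_mult_class_P[OF pq(1-2) z] by simp
    qed (use pq in \<open>auto simp: class_P_def class_P_nonzero intro!: holomorphic_intros\<close>)
  next
    have "(\<lambda>z. z * (?m z * ?m z)) \<in> class_A"
      by (rule class_AI[where h = "\<lambda>z. ?m z * ?m z"]) (auto intro!: holomorphic_intros)
    then show "(\<lambda>z. z * (?m z * ?m z)) \<in> class_G3"
      unfolding class_G3_iff
      by (intro conjI bexI[of _ ?m, OF bexI[of _ ?m]] ballI refl half_plane_map_class_P)
  next
    fix x :: real assume x: "0 < x" "x < 1"
    then have "complex_of_real x \<in> unit_disc" by simp
    from zlogd_mult_class_P[OF half_plane_map_class_P half_plane_map_class_P this]
    show "zlogd (\<lambda>z. ?m z * ?m z) (of_real x) = of_real ((2 * 2 * x + 0 * x\<^sup>2) / (1 - x\<^sup>2))"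
      by (simp add: zlogd_half_plane_map[OF x] add_divide_distrib [symmetric])
  next
    fix z :: complex assume "z \<in> unit_disc"
    then show "?m z * ?m z \<noteq> 0"
      using class_P_nonzero[OF half_plane_map_class_P] by simp
  qed (use quadratic_root[of 0 ?c 2] c in \<open>auto intro!: holomorphic_intros\<close>)
qed

theorem theorem3p2:
  shows "is_radius lemniscate_starlike class_G1
           ((3 - 2 * sqrt 2) / ((sqrt 2 - 1) * (3 + sqrt (12 - 2 * sqrt 2)))) \<and>
         is_radius lemniscate_starlike class_G2
           (2 * (sqrt 2 - 1) / (5 + sqrt (33 - 4 * sqrt 2))) \<and>
         is_radius lemniscate_starlike class_G3
           ((3 - 2 * sqrt 2) / ((sqrt 2 - 1) * (2 + sqrt (7 - 2 * sqrt 2))))"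
  using is_radius_G1 is_radius_G2 is_radius_G3 by simp

end
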